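(* Assume that $\mathbb{S}(I)$ contains the identity map $\mathrm{id}_I$. The semigroup $T_{\mathbb{S}(I)}(X,\mathcal{P})$ is unit-regular if and only if: (i) $\mathbb{S}(I)$ is unit-regular; (ii) for each $\alpha\in U(\mathbb{S}(I))$, we have $|X_i|=|X_{i\alpha}|$ for all $i\in I$; (iii) $X_i$ is finite for all $i\in I$; and (iv) for each $\beta\in \mathbb{S}(I)$ and each $i\in I$, if $|i\beta^{-1}|\geq 2$, then $|X_i|=1$.
   Context: $X$ is a nonempty set (possibly infinite) and $\mathcal{P}=\{X_i : i\in I\}$ is a partition of $X$ into nonempty blocks, with $X_i\cap X_j=\varnothing$ for $i\neq j$. $T(Z)$ denotes the semigroup of all maps $Z\to Z$ under composition. Maps are written on the right and composed from left to right: $x(fg)=(xf)g$; $Af=\{af: a\in A\}$; $i\beta^{-1}=\{k\in I: k\beta=i\}$. $T(X,\mathcal{P})$ is the subsemigroup of all $f\in T(X)$ such that for every $i\in I$ there is $j\in I$ with $X_if\subseteq X_j$. For $f\in T(X,\mathcal{P})$ the character $\chi^{(f)}\in T(I)$ is defined by $i\chi^{(f)}=j$ whenever $X_if\subseteq X_j$. For a subsemigroup $\mathbb{S}(I)$ of $T(I)$, $T_{\mathbb{S}(I)}(X,\mathcal{P})=\{f\in T(X,\mathcal{P}): \chi^{(f)}\in \mathbb{S}(I)\}$, a subsemigroup of $T(X,\mathcal{P})$; it contains $\mathrm{id}_X$ iff $\mathrm{id}_I\in\mathbb{S}(I)$. For a semigroup $S$ with identity, $U(S)$ is its group of units; $S$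 is unit-regular if for every $a\in S$ there is $u\in U(S)$ with $aua=a$. *)

theory Defs
  imports "HOL-Algebra.Group" "HOL-Library.Disjoint_Sets" "HOL-Library.Equipollence"
begin

text \<open>
  A map \<open>Z \<rightarrow> Z\<close> is an element of \<^term>\<open>Z \<rightarrow>\<^sub>E Z\<close>, that is, it is \<^term>\<open>undefined\<close> outside \<open>Z\<close>,
  so that equality of HOL functions is equality of maps. Maps act on the right: the product
  of \<open>f\<close> and \<open>g\<close> is ``first \<open>f\<close>, then \<open>g\<close>''. A submonoid with carrier \<open>S\<close> is written
  \<^term>\<open>(full_transf Z)\<lparr>carrier := S\<rparr>\<close>.
\<close>

definition full_transf :: "'a set \<Rightarrow> ('a \<Rightarrow> 'a) monoid" where
  "full_transf Z = \<lparr>carrier = Z \<rightarrow>\<^sub>E Z, mult = (\<lambda>f g. compose Z g f), one = (\<lambda>x\<in>Z. x)\<rparr>"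

definition subsemigroup :: "'a set \<Rightarrow> ('a, 'm) monoid_scheme \<Rightarrow> bool" where
  "subsemigroup S G \<longleftrightarrow> S \<subseteq> carrier G \<and> (\<forall>x\<in>S. \<forall>y\<in>S. x \<otimes>\<^bsub>G\<^esub> y \<in> S)"

definition unit_regular :: "('a, 'm) monoid_scheme \<Rightarrow> bool" where
  "unit_regular G \<longleftrightarrow> (\<forall>a\<in>carrier G. \<exists>u\<in>Units G. a \<otimes>\<^bsub>G\<^esub> u \<otimes>\<^bsub>G\<^esub> a = a)"

definition indexed_partition :: "'a set \<Rightarrow> 'i set \<Rightarrow> ('i \<Rightarrow> 'a set) \<Rightarrow> bool" where
  "indexed_partition X I B \<longleftrightarrow>
     (\<Union>i\<in>I. B i) = X \<and> (\<forall>i\<in>I. B i \<noteq> {}) \<and> disjoint_family_on B I"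

definition partition_transf :: "'a set \<Rightarrow> 'i set \<Rightarrow> ('i \<Rightarrow> 'a set) \<Rightarrow> ('a \<Rightarrow> 'a) set" where
  "partition_transf X I B =
     {f \<in> carrier (full_transf X). \<forall>i\<in>I. \<exists>j\<in>I. f ` B i \<subseteq> B j}"

definition character :: "'i set \<Rightarrow> ('i \<Rightarrow> 'a set) \<Rightarrow> ('a \<Rightarrow> 'a) \<Rightarrow> 'i \<Rightarrow> 'i" where
  "character I B f = (\<lambda>i\<in>I. THE j. j \<in> I \<and> f ` B i \<subseteq> B j)"

definition char_transf ::
  "'a set \<Rightarrow> 'i set \<Rightarrow> ('i \<Rightarrow> 'a set) \<Rightarrow> ('i \<Rightarrow> 'i) set \<Rightarrow> ('a \<Rightarrow> 'a) set" where
  "char_transf X I B S = {f \<in> partition_transf X I B. character I B f \<in> S}"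

lemma character_eqI:
  assumes P: "indexed_partition X I B" and i: "i \<in> I" and j: "j \<in> I" and sub: "f ` B i \<subseteq> B j"
  shows "character I B f i = j"
proof -
  have ne: "B i \<noteq> {}" and disj: "disjoint_family_on B I"
    using P i by (simp_all add: indexed_partition_def)
  from ne obtain x where x: "x \<in> B i"
    by blast
  have unique: "k = j" if k: "k \<in> I" "f ` B i \<subseteq> B k" for k
  proof (rule ccontr)
    assume "k \<noteq> j"
    then have "B k \<inter> B j = {}"
      by (rule disjoint_family_onD[OF disj k(1) j])
    moreover have "f x \<in> B k" "f x \<in> B j"
      using x sub k(2) by auto
    ultimately show False
      by blast
  qed
  have "(THE k. k \<in> I \<and> f ` B i \<subseteq> B k) = j"
  proof (rule the_equality)
    show "j \<in> I \<and> f ` B i \<subseteq> B j"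
      using j sub by (rule conjI)
    show "k = j" if "k \<in> I \<and> f ` B i \<subseteq> B k" for k
      using unique[of k] that by blast
  qed
  with i show ?thesis
    unfolding character_def restrict_apply by (simp only: if_True)
qed

end

theory Submission
  imports Defs
begin

text \<open>
  Taking characters is multiplicative, and every \<^term>\<open>\<beta> \<in> S\<close> is the character of
  some map of \<^term>\<open>X\<close>; in fact a map with character \<^term>\<open>\<beta>\<close> may be prescribed freely,
  block by block, as long as block \<open>i\<close> is sent into block \<open>\<beta> i\<close>. A unit permutes the blocks by
  a unit of \<^term>\<open>S\<close> and carries each block bijectively onto its image block.

  Necessity comes from applying unit-regularity \<open>f u f = f\<close> to three kinds of map. Any map
  with character \<open>\<alpha>\<close> gives \<open>\<alpha> \<chi>\<^sub>u \<alpha> = \<alpha>\<close>, which is unit-regularity of \<^term>\<open>S\<close>; if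
  \<open>\<alpha>\<close> is a unit this forces \<open>\<chi>\<^sub>u = \<alpha>\<inverse>\<close>, so that \<open>u\<close> is a bijection from block \<open>\<alpha> i\<close> onto
  block \<open>i\<close>. A map with identity character that is injective on a block must be surjective on
  it, as its restriction is inverted by a permutation of that block; so blocks are
  Dedekind-finite. Finally, if \<open>\<beta>\<close> merges two indices \<open>k\<close> and \<open>l\<close> into \<open>i\<close> and block \<open>i\<close>
  contained two points \<open>p\<close> and \<open>q\<close>, let \<open>f\<close> be constant on every block and send block \<open>k\<close> to
  \<open>p\<close> and block \<open>l\<close> to \<open>q\<close>. A unit puts \<open>p\<close> and \<open>q\<close> into one block, on which \<open>f\<close> is constant,
  so \<open>f u f = f\<close> would identify \<open>p\<close> and \<open>q\<close>.

  For sufficiency, let \<open>f\<close> have character \<open>\<beta>\<close> and let \<open>\<beta> \<alpha> \<beta> = \<beta>\<close> with \<open>\<alpha>\<close> a unit. The unit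
  \<open>u\<close> with \<open>f u f = f\<close> is built with character \<open>\<alpha>\<close>, one block at a time, by choosing for each
  point of block \<open>j\<close> in the range of \<open>f\<close> a preimage in block \<open>\<alpha> j\<close> and completing this injective
  partial map to a bijection, as is possible between finite sets of equal size. That there is
  a preimage in that very block is where the singleton condition enters: a preimage in a
  different block means that \<open>\<beta>\<close> merges two indices into \<open>j\<close>, so block \<open>j\<close> has only one point
  and every point of block \<open>\<alpha> j\<close> is sent to it.
\<close>

section \<open>Monoids of transformations, pointwise\<close>

lemma Units_transf_iff:
  assumes "A \<subseteq> Z \<rightarrow>\<^sub>E Z"
  shows "u \<in> Units ((full_transf Z)\<lparr>carrier := A\<rparr>) \<longleftrightarrow>
    u \<in> A \<and> (\<exists>v\<in>A. \<forall>z\<in>Z. v (u z) = z \<and> u (v z) = z)"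
proof -
  have "compose Z g f = (\<lambda>z\<in>Z. z) \<longleftrightarrow> (\<forall>z\<in>Z. g (f z) = z)" for f g :: "'a \<Rightarrow> 'a"
    by (auto simp: compose_def restrict_def fun_eq_iff)
  then show ?thesis
    by (auto simp: Units_def full_transf_def)
qed

lemma unit_regular_transf_iff:
  assumes "A \<subseteq> Z \<rightarrow>\<^sub>E Z"
  shows "unit_regular ((full_transf Z)\<lparr>carrier := A\<rparr>) \<longleftrightarrow>
    (\<forall>a\<in>A. \<exists>u\<in>Units ((full_transf Z)\<lparr>carrier := A\<rparr>). \<forall>z\<in>Z. a (u (a z)) = a z)"
proof -
  have "compose Z a (compose Z u a) = a \<longleftrightarrow> (\<forall>z\<in>Z. a (u (a z)) = a z)"
    if "a \<in> A" for a u
  proof -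
    have "a \<in> extensional Z"
      using that assms by (auto simp: PiE_def)
    then show ?thesis
      by (auto simp: compose_def fun_eq_iff extensional_def)
  qed
  then show ?thesis
    by (simp add: unit_regular_def full_transf_def)
qed

section \<open>Bijections between finite sets that section a given map\<close>

text \<open>
  Choosing preimages gives an injection \<open>D \<rightarrow> C\<close>; the complements of \<open>D\<close> and of its image have
  equal size by finiteness, so any bijection between them completes it.
\<close>

lemma finite_bij_betw_extending_section:
  assumes fin: "finite A" "finite C" and card: "card A = card C"
    and D: "D \<subseteq> A" "D \<subseteq> f ` C"
  obtains u where "bij_betw u A C" "\<And>y. y \<in> D \<Longrightarrow> f (u y) = y"
proof -
  define s where "s = inv_into C f"
  have s: "bij_betw s D (s ` D)" "s ` D \<subseteq> C" "\<And>y. y \<in> D \<Longrightarrow> f (s y) = y"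
    using D(2) unfolding s_def
    by (auto simp: bij_betw_def inj_on_inv_into f_inv_into_f intro: inv_into_into)
  have "card (A - D) = card (C - s ` D)"
    using card fin D(1) s(1,2) bij_betw_same_card[OF s(1)]
    by (simp add: card_Diff_subset finite_subset)
  then obtain t where t: "bij_betw t (A - D) (C - s ` D)"
    using fin by (metis finite_Diff finite_same_card_bij)
  show thesis
  proof
    have "bij_betw (\<lambda>x. if x \<in> D then s x else t x) (D \<union> (A - D)) (s ` D \<union> (C - s ` D))"
      by (rule bij_betw_disjoint_Un[OF s(1) t]) auto
    then show "bij_betw (\<lambda>x. if x \<in> D then s x else t x) A C"
      using D(1) s(2) by (simp add: Un_absorb1)
    show "f (if y \<in> D then s y else t y) = y" if "y \<in> D" for y
      using that s(3) by simp
  qed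
qed

section \<open>Blocks, characters and units\<close>

locale character_monoid =
  fixes X :: "'a set" and I :: "'i set" and B :: "'i \<Rightarrow> 'a set" and S :: "('i \<Rightarrow> 'i) set"
  assumes partition: "indexed_partition X I B"
    and S_subset: "S \<subseteq> I \<rightarrow>\<^sub>E I"
begin

abbreviation T :: "('a \<Rightarrow> 'a) set" where
  "T \<equiv> char_transf X I B S"

abbreviation \<chi> :: "('a \<Rightarrow> 'a) \<Rightarrow> 'i \<Rightarrow> 'i" where
  "\<chi> \<equiv> character I B"

abbreviation UT :: "('a \<Rightarrow> 'a) set" where
  "UT \<equiv> Units ((full_transf X)\<lparr>carrier := T\<rparr>)"

abbreviation US :: "('i \<Rightarrow> 'i) set" where
  "US \<equiv> Units ((full_transf I)\<lparr>carrier := S\<rparr>)"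

definition block :: "'a \<Rightarrow> 'i" where
  "block x = (THE i. i \<in> I \<and> x \<in> B i)"

lemma same_block: "\<lbrakk>i \<in> I; j \<in> I; x \<in> B i; x \<in> B j\<rbrakk> \<Longrightarrow> i = j"
  using partition by (auto simp: indexed_partition_def disjoint_family_on_def)

lemma block_eq: "\<lbrakk>i \<in> I; x \<in> B i\<rbrakk> \<Longrightarrow> block x = i"
  unfolding block_def using same_block by blast

lemma in_XI: "\<lbrakk>i \<in> I; x \<in> B i\<rbrakk> \<Longrightarrow> x \<in> X"
  using partition by (auto simp: indexed_partition_def)

lemma in_XE:
  assumes "x \<in> X" obtains i where "i \<in> I" "x \<in> B i"
  using partition assms by (auto simp: indexed_partition_def)

lemma block_nonempty:
  assumes "i \<in> I" obtains x where "x \<in> B i"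
  using partition assms by (auto simp: indexed_partition_def)

lemma S_closed: "\<lbrakk>\<alpha> \<in> S; i \<in> I\<rbrakk> \<Longrightarrow> \<alpha> i \<in> I"
  using S_subset by auto

lemma T_subset: "T \<subseteq> X \<rightarrow>\<^sub>E X"
  by (auto simp: char_transf_def partition_transf_def full_transf_def)

lemma character_in_S: "f \<in> T \<Longrightarrow> \<chi> f \<in> S"
  by (simp add: char_transf_def)

lemma character_closed: "\<lbrakk>f \<in> T; i \<in> I\<rbrakk> \<Longrightarrow> \<chi> f i \<in> I"
  by (simp add: S_closed character_in_S)

lemma apply_in_block:
  assumes "f \<in> T" "i \<in> I" "x \<in> B i"
  shows "f x \<in> B (\<chi> f i)"
proof -
  obtain j where "j \<in> I" "f ` B i \<subseteq> B j"
    using assms(1,2) by (auto simp: char_transf_def partition_transf_def)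
  then show ?thesis
    using character_eqI[OF partition assms(2)] assms(3) by auto
qed

lemma restrict_in_T:
  assumes \<beta>: "\<beta> \<in> S" and g: "\<And>i x. \<lbrakk>i \<in> I; x \<in> B i\<rbrakk> \<Longrightarrow> g x \<in> B (\<beta> i)"
  shows "restrict g X \<in> T" "\<chi> (restrict g X) = \<beta>"
proof -
  have sub: "restrict g X ` B i \<subseteq> B (\<beta> i)" if "i \<in> I" for i
    using g that by (auto intro: in_XI)
  have "\<chi> (restrict g X) i = \<beta> i" for i
  proof (cases "i \<in> I")
    case True
    show ?thesis
      by (rule character_eqI[OF partition True S_closed[OF \<beta> True] sub[OF True]])
  next
    case False
    moreover have "\<beta> \<in> extensional I"
      using \<beta> S_subset by (auto simp: PiE_def)
    ultimately show ?thesis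
      by (simp add: character_def extensional_def)
  qed
  then show \<chi>: "\<chi> (restrict g X) = \<beta>"
    by (rule ext)
  have "g x \<in> X" if "x \<in> X" for x
    using that by (meson \<beta> g S_closed in_XE in_XI)
  then have "restrict g X \<in> carrier (full_transf X)"
    by (simp add: full_transf_def)
  then show "restrict g X \<in> T"
    unfolding char_transf_def partition_transf_def mem_Collect_eq \<chi>
    using \<beta> sub S_closed[OF \<beta>] by blast
qed

text \<open>
  Maps that are constant on each block realise every character, with the values free within
  the target blocks.
\<close>

lemma constant_on_blocks_lift:
  assumes "\<beta> \<in> S" and c: "\<And>i. i \<in> I \<Longrightarrow> c i \<in> B (\<beta> i)"
  obtains f where "f \<in> T" "\<chi> f = \<beta>" "\<And>i x. \<lbrakk>i \<in> I; x \<in> B i\<rbrakk> \<Longrightarrow> f x = c i"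
proof
  have *: "c (block x) \<in> B (\<beta> i)" if "i \<in> I" "x \<in> B i" for i x
    using that c by (simp add: block_eq)
  show "restrict (\<lambda>x. c (block x)) X \<in> T" "\<chi> (restrict (\<lambda>x. c (block x)) X) = \<beta>"
    by (rule restrict_in_T[OF assms(1) *]; assumption)+
  show "restrict (\<lambda>x. c (block x)) X x = c i" if "i \<in> I" "x \<in> B i" for i x
    using that by (simp add: block_eq in_XI)
qed

lemma character_exists:
  assumes "\<beta> \<in> S" obtains f where "f \<in> T" "\<chi> f = \<beta>"
proof -
  have "\<exists>x. x \<in> B (\<beta> i)" if "i \<in> I" for i
    using that assms by (meson S_closed block_nonempty)
  then obtain c where "\<And>i. i \<in> I \<Longrightarrow> c i \<in> B (\<beta> i)"
    by metis
  then show thesis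
    using constant_on_blocks_lift[OF assms] that by metis
qed

text \<open>Multiplicativity of characters, in the only instance that unit-regularity asks for.\<close>

lemma character_sandwich:
  assumes "f \<in> T" "u \<in> T" and reg: "\<forall>x\<in>X. f (u (f x)) = f x" and i: "i \<in> I"
  shows "\<chi> f (\<chi> u (\<chi> f i)) = \<chi> f i"
proof -
  obtain x where x: "x \<in> B i"
    using i by (rule block_nonempty)
  have "f (u (f x)) \<in> B (\<chi> f (\<chi> u (\<chi> f i)))" "f x \<in> B (\<chi> f i)"
    using assms x by (simp_all add: apply_in_block character_closed)
  then show ?thesis
    using reg i x assms(1,2) by (metis same_block character_closed in_XI)
qed

lemma Units_T_iff: "u \<in> UT \<longleftrightarrow> u \<in> T \<and> (\<exists>v\<in>T. \<forall>x\<in>X. v (u x) = x \<and> u (v x) = x)"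
  by (rule Units_transf_iff[OF T_subset])

lemma Units_S_iff: "\<alpha> \<in> US \<longleftrightarrow> \<alpha> \<in> S \<and> (\<exists>\<gamma>\<in>S. \<forall>i\<in>I. \<gamma> (\<alpha> i) = i \<and> \<alpha> (\<gamma> i) = i)"
  by (rule Units_transf_iff[OF S_subset])

lemma Units_T_in_T: "u \<in> UT \<Longrightarrow> u \<in> T"
  by (simp add: Units_T_iff)

lemma character_left_inverse:
  assumes "u \<in> T" "v \<in> T" and inv: "\<forall>x\<in>X. v (u x) = x" and i: "i \<in> I"
  shows "\<chi> v (\<chi> u i) = i"
proof -
  obtain x where x: "x \<in> B i"
    using i by (rule block_nonempty)
  have "v (u x) \<in> B (\<chi> v (\<chi> u i))"
    using assms x by (simp add: apply_in_block character_closed)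
  then show ?thesis
    using inv i x assms(1,2) by (metis same_block character_closed in_XI)
qed

text \<open>
  The inverse of a unit lies in the monoid as well, so it also respects blocks, and its
  character is inverse to that of the unit.
\<close>

lemma unit_character_and_blocks:
  assumes "u \<in> UT"
  shows "\<chi> u \<in> US" and "i \<in> I \<Longrightarrow> bij_betw u (B i) (B (\<chi> u i))"
proof -
  obtain v where u: "u \<in> T" and v: "v \<in> T"
    and inv: "\<forall>x\<in>X. v (u x) = x" "\<forall>x\<in>X. u (v x) = x"
    using assms by (auto simp: Units_T_iff)
  note \<chi>inv = character_left_inverse[OF u v inv(1)] character_left_inverse[OF v u inv(2)]
  show "\<chi> u \<in> US"
    unfolding Units_S_iff using character_in_S[OF u] character_in_S[OF v] \<chi>inv by blast
  show "bij_betw u (B i) (B (\<chi> u i))" if i: "i \<in> I"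
  proof (rule bij_betw_byWitness[where f' = v])
    show "\<forall>x\<in>B i. v (u x) = x" "\<forall>y\<in>B (\<chi> u i). u (v y) = y"
      using inv i in_XI character_closed[OF u] by blast+
    show "u ` B i \<subseteq> B (\<chi> u i)"
      using apply_in_block[OF u i] by blast
    show "v ` B (\<chi> u i) \<subseteq> B i"
      using apply_in_block[OF v character_closed[OF u i]] \<chi>inv(1)[OF i] by auto
  qed
qed

text \<open>
  Conversely, bijections between the blocks along a unit of \<^term>\<open>S\<close> glue to a unit; the
  inverses of the bijections glue along the inverse unit.
\<close>

lemma glue_unit:
  assumes \<alpha>: "\<alpha> \<in> US" and b: "\<And>j. j \<in> I \<Longrightarrow> bij_betw (b j) (B j) (B (\<alpha> j))"
  obtains u where "u \<in> UT" "\<And>j x. \<lbrakk>j \<in> I; x \<in> B j\<rbrakk> \<Longrightarrow> u x = b j x"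
proof -
  obtain \<gamma> where \<alpha>S: "\<alpha> \<in> S" and \<gamma>S: "\<gamma> \<in> S"
    and \<gamma>: "\<And>i. i \<in> I \<Longrightarrow> \<gamma> (\<alpha> i) = i" "\<And>i. i \<in> I \<Longrightarrow> \<alpha> (\<gamma> i) = i"
    using \<alpha> by (auto simp: Units_S_iff)
  define u where "u = restrict (\<lambda>x. b (block x) x) X"
  \<comment> \<open>Block \<open>j\<close> is the image of block \<open>\<gamma> j\<close>, so it is the bijection of the latter that is inverted.\<close>
  define v where "v = restrict (\<lambda>y. inv_into (B (\<gamma> (block y))) (b (\<gamma> (block y))) y) X"
  have u_eq: "u x = b j x" if "j \<in> I" "x \<in> B j" for j x
    using that by (simp add: u_def block_eq in_XI)
  have v_eq: "v y = inv_into (B (\<gamma> j)) (b (\<gamma> j)) y" if "j \<in> I" "y \<in> B j" for j y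
    using that by (simp add: v_def block_eq in_XI)
  have b': "bij_betw (b (\<gamma> j)) (B (\<gamma> j)) (B j)" if "j \<in> I" for j
    using b[OF S_closed[OF \<gamma>S that]] \<gamma>(2)[OF that] by simp
  have u_in: "u x \<in> B (\<alpha> j)" if "j \<in> I" "x \<in> B j" for j x
    using b[OF that(1)] that by (simp add: u_eq bij_betw_apply)
  have v_in: "v y \<in> B (\<gamma> j)" if "j \<in> I" "y \<in> B j" for j y
    using bij_betw_apply[OF bij_betw_inv_into[OF b'[OF that(1)]] that(2)] that by (simp add: v_eq)
  have "u \<in> T"
    unfolding u_def
    by (rule restrict_in_T(1)[OF \<alpha>S]) (use u_in u_eq in \<open>simp add: block_eq\<close>)
  moreover have "v \<in> T"
    unfolding v_def
    by (rule restrict_in_T(1)[OF \<gamma>S]) (use v_in v_eq in \<open>simp add: block_eq\<close>)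
  moreover have "v (u x) = x \<and> u (v x) = x" if x: "x \<in> X" for x
  proof -
    obtain j where j: "j \<in> I" "x \<in> B j"
      using x by (rule in_XE)
    have "v (u x) = inv_into (B j) (b j) (b j x)"
      using v_eq[OF S_closed[OF \<alpha>S j(1)] u_in[OF j]] u_eq[OF j] \<gamma>(1) j(1) by simp
    moreover have "u (v x) = b (\<gamma> j) (inv_into (B (\<gamma> j)) (b (\<gamma> j)) x)"
      using u_eq[OF S_closed[OF \<gamma>S j(1)] v_in[OF j]] v_eq[OF j] by simp
    ultimately show ?thesis
      using bij_betw_inv_into_left[OF b j(2)] bij_betw_inv_into_right[OF b' j(2)] j(1) by simp
  qed
  ultimately have "u \<in> UT"
    by (auto simp: Units_T_iff)
  then show thesis
    using u_eq that by blast
qed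

section \<open>Necessity\<close>

context
  assumes regular: "unit_regular ((full_transf X)\<lparr>carrier := T\<rparr>)"
begin

lemma regular_obtain:
  assumes "f \<in> T"
  obtains u where "u \<in> UT" "\<And>x. x \<in> X \<Longrightarrow> f (u (f x)) = f x"
  using regular assms unit_regular_transf_iff[OF T_subset] by blast

lemma character_regular_obtain:
  assumes "\<alpha> \<in> S"
  obtains u where "u \<in> UT" "\<And>i. i \<in> I \<Longrightarrow> \<alpha> (\<chi> u (\<alpha> i)) = \<alpha> i"
proof -
  obtain f where f: "f \<in> T" "\<chi> f = \<alpha>"
    using assms by (rule character_exists)
  obtain u where "u \<in> UT" "\<And>x. x \<in> X \<Longrightarrow> f (u (f x)) = f x"
    using regular_obtain[OF f(1)] by blast
  with f that character_sandwich[OF f(1)] Units_T_in_T show thesis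
    by metis
qed

lemma character_monoid_regular: "unit_regular ((full_transf I)\<lparr>carrier := S\<rparr>)"
  unfolding unit_regular_transf_iff[OF S_subset]
proof
  fix \<alpha> assume "\<alpha> \<in> S"
  then obtain u where "u \<in> UT" "\<And>i. i \<in> I \<Longrightarrow> \<alpha> (\<chi> u (\<alpha> i)) = \<alpha> i"
    using character_regular_obtain by blast
  then show "\<exists>\<gamma>\<in>US. \<forall>i\<in>I. \<alpha> (\<gamma> (\<alpha> i)) = \<alpha> i"
    using unit_character_and_blocks(1) by blast
qed

text \<open>
  For invertible \<open>\<alpha>\<close> the only index map \<open>\<gamma>\<close> with \<open>\<alpha> \<gamma> \<alpha> = \<alpha>\<close> is the inverse of \<open>\<alpha>\<close>, which is
  therefore the character of a unit of the transformation monoid.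
\<close>

lemma unit_preserves_block_size:
  assumes "\<alpha> \<in> US" "i \<in> I"
  shows "B i \<approx> B (\<alpha> i)"
proof -
  obtain \<gamma> where \<alpha>: "\<alpha> \<in> S" and \<gamma>: "\<And>i. i \<in> I \<Longrightarrow> \<gamma> (\<alpha> i) = i"
    using assms(1) by (auto simp: Units_S_iff)
  obtain u where u: "u \<in> UT" "\<And>i. i \<in> I \<Longrightarrow> \<alpha> (\<chi> u (\<alpha> i)) = \<alpha> i"
    using character_regular_obtain[OF \<alpha>] by blast
  have "\<alpha> i \<in> I"
    using \<alpha> assms(2) by (rule S_closed)
  then have "\<chi> u (\<alpha> i) = i"
    using u \<gamma> assms(2) by (metis character_closed Units_T_in_T)
  then have "bij_betw u (B (\<alpha> i)) (B i)"
    using unit_character_and_blocks(2)[OF u(1) \<open>\<alpha> i \<in> I\<close>] by simp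
  then show ?thesis
    using eqpoll_def eqpoll_sym by blast
qed

text \<open>
  An injection of the block into itself, extended by the identity, must be inverse to a
  permutation of the block, hence surjective; infinite blocks admit injections that are not.
\<close>

lemma block_finite:
  assumes one: "(\<lambda>i\<in>I. i) \<in> S" and i: "i \<in> I"
  shows "finite (B i)"
proof (rule ccontr)
  assume "infinite (B i)"
  then obtain g where g: "inj_on g (B i)" "g ` B i \<subset> B i"
    unfolding infinite_iff_psubset eqpoll_def bij_betw_def by blast
  define f where "f = restrict (\<lambda>x. if x \<in> B i then g x else x) X"
  have *: "(if x \<in> B i then g x else x) \<in> B ((\<lambda>i\<in>I. i) k)" if "k \<in> I" "x \<in> B k" for k x
    using that i g(2) same_block by fastforce
  have f: "f \<in> T" "\<chi> f = (\<lambda>i\<in>I. i)"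
    unfolding f_def by (rule restrict_in_T[OF one *]; assumption)+
  have f_eq: "f x = g x" if "x \<in> B i" for x
    using that i by (simp add: f_def in_XI)
  obtain u where u: "u \<in> UT" "\<And>x. x \<in> X \<Longrightarrow> f (u (f x)) = f x"
    using regular_obtain[OF f(1)] by blast
  have "\<chi> u i = i"
    using character_sandwich[OF f(1) Units_T_in_T[OF u(1)] _ i] u f(2) i
      character_closed[OF Units_T_in_T[OF u(1)] i] by simp
  then have bij: "bij_betw u (B i) (B i)"
    using unit_character_and_blocks(2)[OF u(1) i] by simp
  have g_in: "g x \<in> B i" if "x \<in> B i" for x
    using g(2) that by blast
  have u_g: "u (g x) = x" if "x \<in> B i" for x
  proof -
    have "u (g x) \<in> B i"
      using bij g_in that by (simp add: bij_betw_apply)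
    moreover from this have "g (u (g x)) = g x"
      using u(2)[OF in_XI[OF i that]] that by (simp add: f_eq)
    ultimately show ?thesis
      using g(1) that by (simp add: inj_on_eq_iff)
  qed
  have "B i \<subseteq> g ` B i"
  proof
    fix y assume y: "y \<in> B i"
    then have uy: "u y \<in> B i"
      using bij by (simp add: bij_betw_apply)
    have "g (u y) = y"
      using inj_onD[OF bij_betw_imp_inj_on[OF bij] u_g[OF uy] g_in[OF uy] y] .
    then show "y \<in> g ` B i"
      using uy by force
  qed
  then show False
    using g(2) by blast
qed

text \<open>
  A unit keeps two points of block \<open>i\<close> together in one block, where a blockwise constant \<open>f\<close>
  cannot tell them apart; yet \<open>f u f = f\<close> says that \<open>u\<close> followed by \<open>f\<close> fixes the range of \<open>f\<close>,
  and merging \<open>k\<close> and \<open>l\<close> allows both points to be in that range.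
\<close>

lemma merged_block_singleton:
  assumes \<beta>: "\<beta> \<in> S" and kl: "k \<in> I" "l \<in> I" "k \<noteq> l" "\<beta> k = i" "\<beta> l = i"
  shows "card (B i) = 1"
proof -
  have i: "i \<in> I"
    using S_closed[OF \<beta> kl(1)] kl(4) by simp
  have "p = q" if pq: "p \<in> B i" "q \<in> B i" for p q
  proof -
    have "\<exists>x. x \<in> B (\<beta> m)" if "m \<in> I" for m
      using that \<beta> by (meson S_closed block_nonempty)
    then obtain c where c: "\<And>m. m \<in> I \<Longrightarrow> c m \<in> B (\<beta> m)"
      by metis
    have "(c(k := p, l := q)) m \<in> B (\<beta> m)" if "m \<in> I" for m
      using that c pq kl by simp
    from constant_on_blocks_lift[OF \<beta> this] obtain f
      where f: "f \<in> T" "\<And>m x. \<lbrakk>m \<in> I; x \<in> B m\<rbrakk> \<Longrightarrow> f x = (c(k := p, l := q)) m"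
      by blast
    obtain u where u: "u \<in> UT" "\<And>x. x \<in> X \<Longrightarrow> f (u (f x)) = f x"
      using regular_obtain[OF f(1)] by blast
    obtain x y where xy: "x \<in> B k" "y \<in> B l"
      using kl(1,2) by (meson block_nonempty)
    have fp: "f x = p" "f y = q"
      using f(2) xy kl by auto
    have "f (u p) = p" "f (u q) = q"
      using u(2)[of x] u(2)[of y] fp xy kl(1,2) in_XI by auto
    moreover have "f (u p) = f (u q)"
      using apply_in_block[OF Units_T_in_T[OF u(1)] i]
        f(2)[OF character_closed[OF Units_T_in_T[OF u(1)] i]] pq by simp
    ultimately show ?thesis
      by metis
  qed
  moreover obtain p where "p \<in> B i"
    using i by (rule block_nonempty)
  ultimately have "B i = {p}"
    by blast
  then show ?thesis
    by simp
qed

end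

section \<open>Sufficiency\<close>

text \<open>
  If a point of block \<open>j\<close> has a preimage outside block \<open>\<alpha> j\<close>, then \<open>\<chi> f\<close> merges two indices
  into \<open>j\<close>, so block \<open>j\<close> has no other point and any point of block \<open>\<alpha> j\<close> is a preimage.
\<close>

lemma range_covered_by_one_block:
  assumes f: "f \<in> T" and \<alpha>: "\<alpha> \<in> S"
    and reg: "\<And>i. i \<in> I \<Longrightarrow> \<chi> f (\<alpha> (\<chi> f i)) = \<chi> f i"
    and merged: "\<And>k l. \<lbrakk>k \<in> I; l \<in> I; k \<noteq> l; \<chi> f k = \<chi> f l\<rbrakk> \<Longrightarrow> card (B (\<chi> f k)) = 1"
    and j: "j \<in> I"
  shows "B j \<inter> f ` X \<subseteq> f ` B (\<alpha> j)"
proof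
  fix y assume "y \<in> B j \<inter> f ` X"
  then obtain x where x: "x \<in> X" "y = f x" and y: "y \<in> B j"
    by blast
  obtain i where i: "i \<in> I" "x \<in> B i"
    using x(1) by (rule in_XE)
  have fi: "\<chi> f i = j"
    using apply_in_block[OF f i] y x(2) same_block character_closed[OF f i(1)] j by blast
  have \<alpha>j: "\<alpha> j \<in> I"
    using \<alpha> j by (rule S_closed)
  have f\<alpha>j: "\<chi> f (\<alpha> j) = j"
    using reg[OF i(1)] fi by simp
  show "y \<in> f ` B (\<alpha> j)"
  proof (cases "i = \<alpha> j")
    case True
    then show ?thesis
      using i x by blast
  next
    case False
    then have "card (B j) = 1"
      using merged[OF i(1) \<alpha>j] fi f\<alpha>j by simp
    moreover obtain z where z: "z \<in> B (\<alpha> j)"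
      using \<alpha>j by (rule block_nonempty)
    moreover have "f z \<in> B j"
      using apply_in_block[OF f \<alpha>j z] f\<alpha>j by simp
    ultimately have "y = f z"
      using y by (metis card_1_singletonE singletonD)
    then show ?thesis
      using z by blast
  qed
qed

lemma char_transf_regularI:
  assumes reg: "unit_regular ((full_transf I)\<lparr>carrier := S\<rparr>)"
    and size: "\<And>\<alpha> i. \<lbrakk>\<alpha> \<in> US; i \<in> I\<rbrakk> \<Longrightarrow> B i \<approx> B (\<alpha> i)"
    and fin: "\<And>i. i \<in> I \<Longrightarrow> finite (B i)"
    and merged: "\<And>\<beta> k l. \<lbrakk>\<beta> \<in> S; k \<in> I; l \<in> I; k \<noteq> l; \<beta> k = \<beta> l\<rbrakk> \<Longrightarrow> card (B (\<beta> k)) = 1"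
  shows "unit_regular ((full_transf X)\<lparr>carrier := T\<rparr>)"
  unfolding unit_regular_transf_iff[OF T_subset]
proof
  fix f assume f: "f \<in> T"
  obtain \<alpha> where \<alpha>: "\<alpha> \<in> US" "\<And>i. i \<in> I \<Longrightarrow> \<chi> f (\<alpha> (\<chi> f i)) = \<chi> f i"
    using reg character_in_S[OF f] unit_regular_transf_iff[OF S_subset] by blast
  have \<alpha>S: "\<alpha> \<in> S"
    using \<alpha>(1) by (simp add: Units_S_iff)
  have "\<exists>b. bij_betw b (B j) (B (\<alpha> j)) \<and> (\<forall>y \<in> B j \<inter> f ` X. f (b y) = y)" if j: "j \<in> I" for j
  proof -
    have "card (B j) = card (B (\<alpha> j))"
      using size[OF \<alpha>(1) j] by (auto simp: eqpoll_def dest: bij_betw_same_card)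
    moreover have "B j \<inter> f ` X \<subseteq> f ` B (\<alpha> j)"
      by (rule range_covered_by_one_block[OF f \<alpha>S \<alpha>(2) merged[OF character_in_S[OF f]] j])
    ultimately obtain b where "bij_betw b (B j) (B (\<alpha> j))" "\<And>y. y \<in> B j \<inter> f ` X \<Longrightarrow> f (b y) = y"
      using finite_bij_betw_extending_section fin[OF j] fin[OF S_closed[OF \<alpha>S j]]
      by (metis Int_lower1)
    then show ?thesis
      by blast
  qed
  then obtain b where b: "\<And>j. j \<in> I \<Longrightarrow> bij_betw (b j) (B j) (B (\<alpha> j))"
    "\<And>j y. \<lbrakk>j \<in> I; y \<in> B j \<inter> f ` X\<rbrakk> \<Longrightarrow> f (b j y) = y"
    by metis
  obtain u where u: "u \<in> UT" "\<And>j x. \<lbrakk>j \<in> I; x \<in> B j\<rbrakk> \<Longrightarrow> u x = b j x"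
    using glue_unit[OF \<alpha>(1) b(1)] by blast
  have "f (u (f x)) = f x" if x: "x \<in> X" for x
  proof -
    have "f x \<in> X"
      using T_subset f x by auto
    then obtain j where "j \<in> I" "f x \<in> B j"
      by (rule in_XE)
    then show ?thesis
      using u(2) b(2) x by simp
  qed
  then show "\<exists>u\<in>UT. \<forall>x\<in>X. f (u (f x)) = f x"
    using u(1) by blast
qed

end

section \<open>The characterization\<close>

lemma two_lepoll_iff: "{..<2::nat} \<lesssim> A \<longleftrightarrow> (\<exists>k\<in>A. \<exists>l\<in>A. k \<noteq> l)"
proof
  assume "{..<2::nat} \<lesssim> A"
  then obtain h where "inj_on h {..<2::nat}" "h ` {..<2} \<subseteq> A"
    by (auto simp: lepoll_def)
  then have "h 0 \<in> A" "h 1 \<in> A" "h 0 \<noteq> h 1"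
    using inj_onD[of h "{..<2}" 0 1] by auto
  then show "\<exists>k\<in>A. \<exists>l\<in>A. k \<noteq> l"
    by blast
next
  assume "\<exists>k\<in>A. \<exists>l\<in>A. k \<noteq> l"
  then obtain k l where "k \<in> A" "l \<in> A" "k \<noteq> l"
    by blast
  then have "inj_on (\<lambda>n. if n = 0 then k else l) {..<2::nat}"
    "(\<lambda>n. if n = 0 then k else l) ` {..<2::nat} \<subseteq> A"
    by (auto simp: inj_on_def)
  then show "{..<2::nat} \<lesssim> A"
    unfolding lepoll_def by blast
qed

theorem theorem4p6:
  fixes X :: "'a set" and I :: "'i set" and B :: "'i \<Rightarrow> 'a set" and S :: "('i \<Rightarrow> 'i) set"
  assumes "X \<noteq> {}"
    and "indexed_partition X I B"
    and "subsemigroup S (full_transf I)"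
    and "(\<lambda>i\<in>I. i) \<in> S"
  shows "unit_regular ((full_transf X)\<lparr>carrier := char_transf X I B S\<rparr>) \<longleftrightarrow>
      unit_regular ((full_transf I)\<lparr>carrier := S\<rparr>)
    \<and> (\<forall>\<alpha>\<in>Units ((full_transf I)\<lparr>carrier := S\<rparr>). \<forall>i\<in>I. B i \<approx> B (\<alpha> i))
    \<and> (\<forall>i\<in>I. finite (B i))
    \<and> (\<forall>\<beta>\<in>S. \<forall>i\<in>I. {..<2::nat} \<lesssim> {k \<in> I. \<beta> k = i} \<longrightarrow> card (B i) = 1)"
    (is "?reg \<longleftrightarrow> ?i \<and> ?ii \<and> ?iii \<and> ?iv")
proof -
  interpret character_monoid X I B S
    using assms(2,3) by unfold_locales (simp_all add: subsemigroup_def full_transf_def)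
  show ?thesis
  proof
    assume reg: ?reg
    have ?iv
      unfolding two_lepoll_iff using merged_block_singleton[OF reg] by blast
    then show "?i \<and> ?ii \<and> ?iii \<and> ?iv"
      using character_monoid_regular[OF reg] unit_preserves_block_size[OF reg]
        block_finite[OF reg assms(4)] by blast
  next
    assume conds: "?i \<and> ?ii \<and> ?iii \<and> ?iv"
    have "card (B (\<beta> k)) = 1" if "\<beta> \<in> S" "k \<in> I" "l \<in> I" "k \<noteq> l" "\<beta> k = \<beta> l" for \<beta> k l
    proof -
      have "{..<2::nat} \<lesssim> {m \<in> I. \<beta> m = \<beta> k}"
        unfolding two_lepoll_iff using that by force
      then show ?thesis
        using conds S_closed[OF that(1,2)] that(1) by blast
    qed
    then show ?reg
      using conds by (intro char_transf_regularI) blast+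
  qed
qed

end
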